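(* Let $G=(\mathcal V,\mathcal E)$ be a graph with $\mathcal V\subset\mathbb R^d$. Assume that $G$ has maximal vertex degree $d_{\max}:=\sup_{v\in\mathcal V}d_G(v)\in\mathbb N\setminus\{1\}$ and maximal edge length $l_{\max}:=\sup\{|u-v|:\{u,v\}\in\mathcal E\}<\infty$. Then for every $p\in\,]0,1]$ there exists a real number $\psi(p)$ such that the probability $g^p_{G,v}(n):=\mathbb P_G^p(A_v(n))$ satisfies $$g^p_{G,v}(n)\le2\,e^{-n\psi(p)}$$ for all $n\in\mathbb N$, uniformly in $v\in\mathcal V$. A possible choice of $\psi(p)$ is, for $0<p\le1$, $$\psi(p)=\frac1{l_{\max}}\ln\Bigl(\frac1{p(d_{\max}-1)}\Bigr).$$ In particular, $g^p_{G,v}(n)$ decays exponentially in $n$ if $p<1/(d_{\max}-1)$.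
   Context: Graphs are simple (no loops, no multiple edges) with countable vertex set in $\mathbb R^d$; $d_G(v)$ is the degree of $v$. Bernoulli bond percolation: $\Omega_G:=\{0,1\}^{\mathcal E}$ with product measure $\mathbb P_G^p:=\bigotimes_{e\in\mathcal E}(p\,\delta_1+(1-p)\delta_0)$; for $\omega\in\Omega_G$, $G^{(\omega)}$ is the subgraph with vertex set $\mathcal V$ and edge set $\{e\in\mathcal E:\omega_e=1\}$. $B_n(v)$ is the open Euclidean ball of radius $n$ about $v$, and $A_v(n)\subseteq\Omega_G$ is the event that there is a path in $G^{(\omega)}$ from $v$ to some vertex in the complement $B_n(v)^c$. *)

theory Defs
  imports "HOL-Probability.Probability"
begin

definition simple_graph :: "'a set \<Rightarrow> 'a set set \<Rightarrow> bool" where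
  "simple_graph V E \<longleftrightarrow>
     countable V \<and> E \<subseteq> {{u, v} |u v. u \<in> V \<and> v \<in> V \<and> u \<noteq> v}"

definition degree :: "'a set set \<Rightarrow> 'a \<Rightarrow> enat" where
  "degree E v =
     (if finite {e \<in> E. v \<in> e} then enat (card {e \<in> E. v \<in> e}) else \<infinity>)"

definition max_degree :: "'a set \<Rightarrow> 'a set set \<Rightarrow> enat" where
  "max_degree V E = (SUP v\<in>V. degree E v)"

text \<open>Taken in \<^typ>\<open>ereal\<close>, so that an unbounded set of edge lengths has
  supremum \<open>\<infinity>\<close>.\<close>

definition max_edge_length :: "'a::real_normed_vector set set \<Rightarrow> ereal" where
  "max_edge_length E = Sup {ereal (norm (u - v)) |u v. {u, v} \<in> E}"

definition path_in :: "'a set \<Rightarrow> 'a set set \<Rightarrow> 'a list \<Rightarrow> bool" where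
  "path_in V E xs \<longleftrightarrow>
     xs \<noteq> [] \<and> set xs \<subseteq> V \<and> distinct xs \<and> successively (\<lambda>x y. {x, y} \<in> E) xs"

text \<open>The states 1 and 0 of an edge are encoded as \<^const>\<open>True\<close> and
  \<^const>\<open>False\<close>; configurations are functions that are \<^const>\<open>undefined\<close> outside the
  edge set.\<close>

definition config_space :: "'a set set \<Rightarrow> ('a set \<Rightarrow> bool) set" where
  "config_space E = E \<rightarrow>\<^sub>E UNIV"

definition percolation :: "'a set set \<Rightarrow> real \<Rightarrow> ('a set \<Rightarrow> bool) measure" where
  "percolation E p = (\<Pi>\<^sub>M e\<in>E. measure_pmf (bernoulli_pmf p))"

definition open_edges :: "'a set set \<Rightarrow> ('a set \<Rightarrow> bool) \<Rightarrow> 'a set set" where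
  "open_edges E \<omega> = {e \<in> E. \<omega> e}"

definition escape_event ::
  "'a::real_normed_vector set \<Rightarrow> 'a set set \<Rightarrow> 'a \<Rightarrow> nat \<Rightarrow> ('a set \<Rightarrow> bool) set" where
  "escape_event V E v n =
     {\<omega> \<in> config_space E.
        \<exists>xs. path_in V (open_edges E \<omega>) xs \<and> hd xs = v \<and> last xs \<notin> ball v (real n)}"

definition escape_prob ::
  "'a::real_normed_vector set \<Rightarrow> 'a set set \<Rightarrow> real \<Rightarrow> 'a \<Rightarrow> nat \<Rightarrow> real" where
  "escape_prob V E p v n = measure (percolation E p) (escape_event V E v n)"

lemma prob_space_percolation: "prob_space (percolation E p)"
  unfolding percolation_def
  by (intro prob_space_PiM measure_pmf.prob_space_axioms)

lemma space_percolation: "space (percolation E p) = config_space E"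
  by (simp add: percolation_def config_space_def space_PiM)

lemma sets_open_edge:
  assumes "e \<in> E"
  shows "{\<omega> \<in> config_space E. \<omega> e} \<in> sets (percolation E p)"
proof -
  have "(\<lambda>\<omega>. \<omega> e) \<in> measurable (percolation E p) (measure_pmf (bernoulli_pmf p))"
    unfolding percolation_def using assms by (rule measurable_component_singleton)
  then have "(\<lambda>\<omega>. \<omega> e) -` {True} \<inter> space (percolation E p) \<in> sets (percolation E p)"
    by (rule measurable_sets) simp
  moreover have "(\<lambda>\<omega>. \<omega> e) -` {True} \<inter> space (percolation E p) = {\<omega> \<in> config_space E. \<omega> e}"
    by (auto simp: space_percolation)
  ultimately show ?thesis by simp
qed

lemma sets_successively_open:
  "{\<omega> \<in> config_space E. successively (\<lambda>x y. {x, y} \<in> open_edges E \<omega>) xs}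
     \<in> sets (percolation E p)"
proof (induction "\<lambda>x y. {x, y} \<in> E" xs rule: successively.induct)
  case (3 x y zs)
  have "{\<omega> \<in> config_space E. successively (\<lambda>x y. {x, y} \<in> open_edges E \<omega>) (x # y # zs)}
      = (if {x, y} \<in> E then {\<omega> \<in> config_space E. \<omega> {x, y}} else {})
        \<inter> {\<omega> \<in> config_space E. successively (\<lambda>x y. {x, y} \<in> open_edges E \<omega>) (y # zs)}"
    by (auto simp: open_edges_def)
  also have "\<dots> \<in> sets (percolation E p)"
    using 3 sets_open_edge[of "{x, y}" E p] by (intro sets.Int) auto
  finally show ?case .
qed (simp_all add: space_percolation[of E p, symmetric])

lemma escape_event_measurable:
  assumes "simple_graph V E"
  shows "escape_event V E v n \<in> sets (percolation E p)"
proof -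
  let ?X = "{xs \<in> lists V. xs \<noteq> [] \<and> distinct xs \<and> hd xs = v \<and> last xs \<notin> ball v (real n)}"
  have "countable ?X"
    using assms by (intro countable_subset[of ?X "lists V"]) (auto simp: simple_graph_def)
  moreover have "escape_event V E v n =
      (\<Union>xs\<in>?X. {\<omega> \<in> config_space E. successively (\<lambda>x y. {x, y} \<in> open_edges E \<omega>) xs})"
    by (auto simp: escape_event_def path_in_def lists_eq_set)
  ultimately show ?thesis
    using sets_successively_open[of E _ p] by (auto intro!: sets.countable_UN')
qed

end

theory Submission
  imports Defs
begin

text \<open>A path that leaves the ball of radius \<open>n\<close> about \<open>v\<close> has at least \<open>n / l\<^sub>m\<^sub>a\<^sub>x\<close> edges, so it has
  an initial segment with exactly \<open>m = \<lceil>n / l\<^sub>m\<^sub>a\<^sub>x\<rceil>\<close> edges. A self-avoiding path cannot turn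
  back, hence there are at most \<open>d (d - 1)\<^sup>m\<^sup>-\<^sup>1\<close> such segments, \<open>d\<close> being the maximal degree, and
  each is open with probability \<open>p\<^sup>m\<close>. The union bound gives \<open>2 (p (d - 1))\<^sup>m\<close>, since
  \<open>d \<le> 2 (d - 1)\<close>; if \<open>p (d - 1) > 1\<close>, the claimed bound exceeds 1.\<close>

section \<open>Counting self-avoiding paths\<close>

lemma simple_graphD:
  assumes "simple_graph V E" "{u, v} \<in> E"
  shows "u \<in> V" "v \<in> V" "u \<noteq> v"
  using assms by (auto simp: simple_graph_def doubleton_eq_iff)

definition neighbours :: "'a set set \<Rightarrow> 'a \<Rightarrow> 'a set" where
  "neighbours E v = {w. {v, w} \<in> E}"

text \<open>The degree counts incident edges, whereas the path count needs next vertices; sending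
  \<open>w\<close> to \<open>{v, w}\<close> embeds the latter into the former.\<close>

lemma neighbours_bounded:
  assumes "degree E v \<le> enat d"
  shows "finite (neighbours E v)" and "card (neighbours E v) \<le> d"
proof -
  have fin: "finite {e \<in> E. v \<in> e}" and card: "card {e \<in> E. v \<in> e} \<le> d"
    using assms by (auto simp: degree_def split: if_splits)
  have inj: "inj_on (\<lambda>w. {v, w}) (neighbours E v)"
    by (auto simp: inj_on_def doubleton_eq_iff)
  have sub: "(\<lambda>w. {v, w}) ` neighbours E v \<subseteq> {e \<in> E. v \<in> e}"
    by (auto simp: neighbours_def)
  show "finite (neighbours E v)"
    using inj_on_finite[OF inj sub fin] .
  show "card (neighbours E v) \<le> d"
    using card_inj_on_le[OF inj sub fin] card by linarith
qed

text \<open>Indexed by the number \<open>k\<close> of edges, which is the exponent of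
  \<open>p\<close> later on; hence \<open>Suc k\<close> vertices.\<close>

definition paths_from :: "'a set \<Rightarrow> 'a set set \<Rightarrow> nat \<Rightarrow> 'a \<Rightarrow> 'a list set" where
  "paths_from V E k v = {xs. path_in V E xs \<and> hd xs = v \<and> length xs = Suc k}"

lemma paths_from_Suc_Cons:
  assumes "xs \<in> paths_from V E (Suc k) v"
  obtains ys w where "xs = v # ys" "w \<in> neighbours E v" "ys \<in> paths_from V E k w" "v \<notin> set ys"
proof -
  from assms obtain w zs where "xs = v # w # zs"
    by (auto simp: paths_from_def length_Suc_conv)
  with assms show thesis
    by (intro that[of "w # zs" w]) (auto simp: paths_from_def path_in_def neighbours_def)
qed

text \<open>One step of the path count: \<open>I\<close> will hold the possible next vertices,
  \<open>A i\<close> the continuations from \<open>i\<close>, and \<open>f\<close> prefixes the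
  current vertex.\<close>

lemma finite_card_UN_image_le:
  assumes "finite I" "card I \<le> a" "\<And>i. i \<in> I \<Longrightarrow> finite (A i) \<and> card (A i) \<le> b"
    and "S \<subseteq> (\<Union>i\<in>I. f ` A i)"
  shows "finite S \<and> card S \<le> a * b"
proof -
  have fin: "finite (\<Union>i\<in>I. f ` A i)"
    using assms by auto
  have "card S \<le> card (\<Union>i\<in>I. f ` A i)"
    using fin assms(4) by (rule card_mono)
  also have "\<dots> \<le> (\<Sum>i\<in>I. card (f ` A i))"
    using assms(1) by (rule card_UN_le)
  also have "\<dots> \<le> (\<Sum>i\<in>I. b)"
    using assms(3) by (intro sum_mono) (meson card_image_le order_trans)
  also have "\<dots> \<le> a * b"
    using assms(2) by simp
  finally show ?thesis
    using finite_subset[OF assms(4) fin] by blast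
qed

text \<open>Think of \<open>u\<close> as the vertex just left. It is a neighbour of \<open>v\<close>
  and forbidden, so at most \<open>d - 1\<close> next vertices remain; after the step
  \<open>v\<close> takes over the role of \<open>u\<close>. Forgetting all earlier vertices only
  enlarges the count.\<close>

lemma paths_from_avoiding_card:
  assumes graph: "simple_graph V E" and deg: "\<And>v. v \<in> V \<Longrightarrow> degree E v \<le> enat d"
    and "{u, v} \<in> E"
  shows "finite {xs \<in> paths_from V E k v. u \<notin> set xs} \<and>
         card {xs \<in> paths_from V E k v. u \<notin> set xs} \<le> (d - 1) ^ k"
  using \<open>{u, v} \<in> E\<close>
proof (induction k arbitrary: u v)
  case 0
  have "{xs \<in> paths_from V E 0 v. u \<notin> set xs} \<subseteq> {[v]}"
    by (auto simp: paths_from_def length_Suc_conv)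
  then show ?case
    using card_mono[of "{[v]}" "{xs \<in> paths_from V E 0 v. u \<notin> set xs}"]
    by (auto intro: finite_subset)
next
  case (Suc k)
  have v: "v \<in> V"
    using simple_graphD[OF graph Suc.prems] by simp
  have u: "u \<in> neighbours E v"
    using Suc.prems by (simp add: neighbours_def insert_commute)
  have "finite {xs \<in> paths_from V E (Suc k) v. u \<notin> set xs} \<and>
        card {xs \<in> paths_from V E (Suc k) v. u \<notin> set xs} \<le> (d - 1) * (d - 1) ^ k"
  proof (rule finite_card_UN_image_le)
    show "finite (neighbours E v - {u})" "card (neighbours E v - {u}) \<le> d - 1"
      using neighbours_bounded[OF deg[OF v]] u by (auto simp: card_Diff_singleton)
    show "finite {xs \<in> paths_from V E k w. v \<notin> set xs} \<and>
          card {xs \<in> paths_from V E k w. v \<notin> set xs} \<le> (d - 1) ^ k"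
      if "w \<in> neighbours E v - {u}" for w
      using that by (intro Suc.IH) (simp add: neighbours_def)
    show "{xs \<in> paths_from V E (Suc k) v. u \<notin> set xs} \<subseteq>
          (\<Union>w\<in>neighbours E v - {u}. Cons v ` {xs \<in> paths_from V E k w. v \<notin> set xs})"
    proof safe
      fix xs assume xs: "xs \<in> paths_from V E (Suc k) v" "u \<notin> set xs"
      from xs(1) obtain ys w where ys: "xs = v # ys" "w \<in> neighbours E v"
        "ys \<in> paths_from V E k w" "v \<notin> set ys"
        by (rule paths_from_Suc_Cons)
      \<comment> \<open>\<open>w\<close> is the head of \<open>ys\<close>, so it lies on
        \<open>xs\<close>, which avoids \<open>u\<close>; hence \<open>w\<close> differs from
        \<open>u\<close>.\<close>
      then have "w \<in> set ys"
        by (auto simp: paths_from_def path_in_def)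
      with ys xs(2) show
        "xs \<in> (\<Union>w\<in>neighbours E v - {u}. Cons v ` {xs \<in> paths_from V E k w. v \<notin> set xs})"
        by auto
    qed
  qed
  then show ?case
    by simp
qed

text \<open>The starting vertex has no predecessor to exclude, so the first step has up to
  \<open>d\<close> choices; from then on the vertex just left is excluded.\<close>

lemma paths_from_card:
  assumes graph: "simple_graph V E" and deg: "\<And>v. v \<in> V \<Longrightarrow> degree E v \<le> enat d"
    and "v \<in> V"
  shows "finite (paths_from V E (Suc k) v)"
    and "card (paths_from V E (Suc k) v) \<le> d * (d - 1) ^ k"
proof -
  have "finite (paths_from V E (Suc k) v) \<and>
        card (paths_from V E (Suc k) v) \<le> d * (d - 1) ^ k"
  proof (rule finite_card_UN_image_le)
    show "finite (neighbours E v)" "card (neighbours E v) \<le> d"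
      using neighbours_bounded[OF deg[OF \<open>v \<in> V\<close>]] by auto
    show "finite {xs \<in> paths_from V E k w. v \<notin> set xs} \<and>
          card {xs \<in> paths_from V E k w. v \<notin> set xs} \<le> (d - 1) ^ k"
      if "w \<in> neighbours E v" for w
      using that by (intro paths_from_avoiding_card graph deg) (simp_all add: neighbours_def)
    show "paths_from V E (Suc k) v \<subseteq>
          (\<Union>w\<in>neighbours E v. Cons v ` {xs \<in> paths_from V E k w. v \<notin> set xs})"
      by (auto elim!: paths_from_Suc_Cons)
  qed
  then show "finite (paths_from V E (Suc k) v)"
    and "card (paths_from V E (Suc k) v) \<le> d * (d - 1) ^ k"
    by auto
qed

section \<open>The probability that a path is open\<close>

text \<open>Collecting the edges in a finite set turns openness of a path into a cylinder event of
  the product space.\<close>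

fun path_edges :: "'a list \<Rightarrow> 'a set set" where
  "path_edges (x # y # zs) = insert {x, y} (path_edges (y # zs))"
| "path_edges _ = {}"

lemma path_edges_subset_set: "e \<in> path_edges xs \<Longrightarrow> e \<subseteq> set xs"
  by (induction xs rule: path_edges.induct) auto

lemma finite_path_edges: "finite (path_edges xs)"
  by (induction xs rule: path_edges.induct) auto

text \<open>No edge repeats: the first edge contains the first vertex, which all later edges avoid.
  This gives the open probability its full exponent.\<close>

lemma card_path_edges: "distinct xs \<Longrightarrow> card (path_edges xs) = length xs - 1"
proof (induction xs rule: path_edges.induct)
  case (1 x y zs)
  have "{x, y} \<notin> path_edges (y # zs)"
    using path_edges_subset_set[of "{x, y}" "y # zs"] 1(2) by auto
  with 1 show ?case
    by (simp add: finite_path_edges)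
qed auto

lemma successively_edge_iff: "successively (\<lambda>x y. {x, y} \<in> F) xs \<longleftrightarrow> path_edges xs \<subseteq> F"
  by (induction xs rule: path_edges.induct) auto

lemma prob_all_open:
  assumes "finite S" "S \<subseteq> E" "0 \<le> p" "p \<le> 1"
  shows "measure (percolation E p) {\<omega> \<in> config_space E. \<forall>e\<in>S. \<omega> e} = p ^ card S"
proof -
  interpret product_prob_space "\<lambda>_. measure_pmf (bernoulli_pmf p)" E
    by unfold_locales
  \<comment> \<open>The event is the cylinder over \<open>S\<close> with each coordinate there fixed
    to \<open>True\<close>, so its measure factorises over \<open>S\<close>.\<close>
  have "{\<omega> \<in> config_space E. \<forall>e\<in>S. \<omega> e} =
        prod_emb E (\<lambda>_. measure_pmf (bernoulli_pmf p)) S (\<Pi>\<^sub>E e\<in>S. {True})"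
    using assms(2) by (subst prod_emb_PiE) (auto simp: config_space_def PiE_iff extensional_def split: if_splits)
  then have "measure (percolation E p) {\<omega> \<in> config_space E. \<forall>e\<in>S. \<omega> e} =
        (\<Prod>e\<in>S. measure (measure_pmf (bernoulli_pmf p)) {True})"
    using assms measure_PiM_emb[of S "\<lambda>_. {True}"] by (simp add: percolation_def)
  also have "\<dots> = p ^ card S"
    using assms by (simp add: measure_pmf_single)
  finally show ?thesis .
qed

lemma prob_path_open:
  assumes "path_in V E xs" "0 \<le> p" "p \<le> 1"
  shows "measure (percolation E p)
           {\<omega> \<in> config_space E. successively (\<lambda>x y. {x, y} \<in> open_edges E \<omega>) xs}
         = p ^ (length xs - 1)"
proof -
  have sub: "path_edges xs \<subseteq> E" and dist: "distinct xs"
    using assms(1) by (auto simp: path_in_def successively_edge_iff)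
  have "{\<omega> \<in> config_space E. successively (\<lambda>x y. {x, y} \<in> open_edges E \<omega>) xs} =
        {\<omega> \<in> config_space E. \<forall>e\<in>path_edges xs. \<omega> e}"
    unfolding successively_edge_iff using sub by (auto simp: open_edges_def)
  then show ?thesis
    using prob_all_open[OF finite_path_edges sub assms(2,3)] card_path_edges[OF dist] by simp
qed

section \<open>Paths leaving a ball\<close>

text \<open>Iterated triangle inequality; read backwards, it bounds from below the number of edges
  needed to get far from the start.\<close>

lemma path_displacement:
  fixes xs :: "'a::real_normed_vector list"
  assumes len: "\<And>u v. {u, v} \<in> E \<Longrightarrow> dist u v \<le> l"
    and "xs \<noteq> []" "successively (\<lambda>x y. {x, y} \<in> E) xs"
  shows "dist (hd xs) (last xs) \<le> real (length xs - 1) * l"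
  using assms(2,3)
proof (induction xs rule: path_edges.induct)
  case (1 x y zs)
  have "dist x (last (y # zs)) \<le> dist x y + dist y (last (y # zs))"
    by (rule dist_triangle)
  with 1 len[of x y] show ?case
    by (simp add: algebra_simps)
qed auto

lemma path_in_take:
  assumes "path_in V E xs"
  shows "path_in V E (take (Suc k) xs)"
proof -
  have "successively (\<lambda>x y. {x, y} \<in> E) (take (Suc k) xs @ drop (Suc k) xs)"
    using assms by (simp add: path_in_def)
  then have "successively (\<lambda>x y. {x, y} \<in> E) (take (Suc k) xs)"
    unfolding successively_append_iff by blast
  then show ?thesis
    using assms set_take_subset[of "Suc k" xs] by (auto simp: path_in_def)
qed

lemma path_in_mono: "path_in V F xs \<Longrightarrow> F \<subseteq> E \<Longrightarrow> path_in V E xs"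
  by (auto simp: path_in_def successively_edge_iff)

text \<open>Truncation to a fixed number of edges replaces escaping paths of arbitrary length by an
  index set that does not depend on \<open>\<omega>\<close> and that a degree bound makes finite, as
  the union bound requires.\<close>

lemma escape_event_subset:
  fixes V :: "'a::real_normed_vector set"
  assumes len: "\<And>u v. {u, v} \<in> E \<Longrightarrow> dist u v \<le> l" and "0 < l"
  shows "escape_event V E v n \<subseteq>
    (\<Union>xs\<in>paths_from V E (nat \<lceil>real n / l\<rceil>) v.
       {\<omega> \<in> config_space E. successively (\<lambda>x y. {x, y} \<in> open_edges E \<omega>) xs})"
proof
  fix \<omega> assume "\<omega> \<in> escape_event V E v n"
  then obtain xs where \<omega>: "\<omega> \<in> config_space E" and xs: "path_in V (open_edges E \<omega>) xs"
    "hd xs = v" "last xs \<notin> ball v (real n)"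
    by (auto simp: escape_event_def)
  define k where "k = nat \<lceil>real n / l\<rceil>"
  have sub: "open_edges E \<omega> \<subseteq> E"
    by (auto simp: open_edges_def)
  have "xs \<noteq> []"
    using xs(1) by (simp add: path_in_def)
  have "real n \<le> dist (hd xs) (last xs)"
    using xs by simp
  also have "\<dots> \<le> real (length xs - 1) * l"
    using path_in_mono[OF xs(1) sub] by (intro path_displacement[OF len]) (auto simp: path_in_def)
  finally have "real n / l \<le> real (length xs - 1)"
    using \<open>0 < l\<close> by (simp add: field_simps)
  then have "k \<le> length xs - 1"
    by (simp add: k_def nat_le_iff ceiling_le_iff)
  \<comment> \<open>Subtraction is truncated: for \<open>k = 0\<close> the preceding inequality also
    holds for the empty list, so \<open>xs \<noteq> []\<close> enters here.\<close>
  then have length: "length (take (Suc k) xs) = Suc k"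
    using \<open>xs \<noteq> []\<close> by (cases xs) auto
  have path: "path_in V (open_edges E \<omega>) (take (Suc k) xs)"
    using xs(1) by (rule path_in_take)
  have "take (Suc k) xs \<in> paths_from V E k v"
    using path_in_mono[OF path sub] length xs(2) by (simp add: paths_from_def)
  moreover have "successively (\<lambda>x y. {x, y} \<in> open_edges E \<omega>) (take (Suc k) xs)"
    using path by (simp add: path_in_def)
  ultimately show "\<omega> \<in> (\<Union>xs\<in>paths_from V E (nat \<lceil>real n / l\<rceil>) v.
       {\<omega> \<in> config_space E. successively (\<lambda>x y. {x, y} \<in> open_edges E \<omega>) xs})"
    using \<omega> unfolding k_def[symmetric] by blast
qed

section \<open>Union bound and exponential decay\<close>

lemma escape_prob_le_power:
  fixes V :: "'a::real_normed_vector set"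
  assumes graph: "simple_graph V E" and deg: "\<And>v. v \<in> V \<Longrightarrow> degree E v \<le> enat d"
    and "2 \<le> d" and len: "\<And>u v. {u, v} \<in> E \<Longrightarrow> dist u v \<le> l" and "0 < l"
    and p: "0 \<le> p" "p \<le> 1" and "v \<in> V" "0 < n"
  shows "escape_prob V E p v n \<le> 2 * (p * (real d - 1)) ^ nat \<lceil>real n / l\<rceil>"
proof -
  interpret prob_space "percolation E p"
    by (rule prob_space_percolation)
  define m where "m = nat \<lceil>real n / l\<rceil>"
  \<comment> \<open>As \<open>n\<close> is positive, \<open>m\<close> is at least 1, so the first
    step with its \<open>d\<close> choices can be split off.\<close>
  have "0 < real n / l"
    using \<open>0 < l\<close> \<open>0 < n\<close> by simp
  then obtain k where k: "m = Suc k"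
    by (cases m) (auto simp: m_def)
  let ?O = "\<lambda>xs. {\<omega> \<in> config_space E. successively (\<lambda>x y. {x, y} \<in> open_edges E \<omega>) xs}"
  note paths = paths_from_card[OF graph deg \<open>v \<in> V\<close>, where k = k, folded k]
  have "escape_prob V E p v n \<le> prob (\<Union>xs\<in>paths_from V E m v. ?O xs)"
    unfolding escape_prob_def
    using escape_event_subset[of E l V v n, OF len \<open>0 < l\<close>] paths(1)
    by (intro finite_measure_mono sets.finite_UN sets_successively_open) (auto simp: m_def)
  also have "\<dots> \<le> (\<Sum>xs\<in>paths_from V E m v. prob (?O xs))"
    using paths(1) sets_successively_open[of E _ p]
    by (intro finite_measure_subadditive_finite) auto
  also have "\<dots> = (\<Sum>xs\<in>paths_from V E m v. p ^ m)"
  proof (rule sum.cong[OF refl])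
    fix xs assume "xs \<in> paths_from V E m v"
    then have "path_in V E xs" and "length xs - 1 = m"
      by (auto simp: paths_from_def)
    then show "prob (?O xs) = p ^ m"
      using prob_path_open[of V E xs p] p by simp
  qed
  also have "\<dots> = real (card (paths_from V E m v)) * p ^ m"
    by simp
  also have "\<dots> \<le> real (d * (d - 1) ^ k) * p ^ m"
    using paths(2) p by (intro mult_right_mono of_nat_mono) auto
  \<comment> \<open>The exceptional factor \<open>d\<close> of the first step is traded for another
    \<open>d - 1\<close>, at the price of the constant 2.\<close>
  also have "\<dots> \<le> real (2 * (d - 1) * (d - 1) ^ k) * p ^ m"
    using \<open>2 \<le> d\<close> p by (intro mult_right_mono of_nat_mono mult_le_mono1) auto
  also have "\<dots> = 2 * (p * (real d - 1)) ^ m"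
    using \<open>2 \<le> d\<close> by (simp add: k of_nat_diff power_mult_distrib mult_ac)
  finally show ?thesis
    by (simp add: m_def)
qed

lemma escape_prob_le_exp:
  fixes V :: "'a::real_normed_vector set"
  assumes graph: "simple_graph V E" and deg: "\<And>v. v \<in> V \<Longrightarrow> degree E v \<le> enat d"
    and "2 \<le> d" and len: "\<And>u v. {u, v} \<in> E \<Longrightarrow> dist u v \<le> l" and "0 < l"
    and p: "0 < p" "p \<le> 1" and "v \<in> V"
  shows "escape_prob V E p v n \<le> 2 * exp (- real n * (1 / l * ln (1 / (p * (real d - 1)))))"
proof -
  interpret prob_space "percolation E p"
    by (rule prob_space_percolation)
  define q where "q = p * (real d - 1)"
  have q: "0 < q"
    using p \<open>2 \<le> d\<close> by (simp add: q_def)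
  have exponent: "- real n * (1 / l * ln (1 / q)) = real n / l * ln q"
    using q by (simp add: ln_div)
  show ?thesis
  \<comment> \<open>If \<open>q > 1\<close>, rounding the exponent up would enlarge the power, but
    then, as for \<open>n = 0\<close>, the right-hand side is at least 2 and the bound is
    trivial.\<close>
  proof (cases "n = 0 \<or> 1 < q")
    case True
    then have "1 \<le> exp (real n / l * ln q)"
      using q \<open>0 < l\<close> by auto
    moreover have "escape_prob V E p v n \<le> 1"
      by (simp add: escape_prob_def)
    ultimately show ?thesis
      unfolding q_def[symmetric] exponent by linarith
  next
    case False
    then have "escape_prob V E p v n \<le> 2 * q ^ nat \<lceil>real n / l\<rceil>"
      unfolding q_def using assms by (intro escape_prob_le_power) auto
    also have "q ^ nat \<lceil>real n / l\<rceil> = exp (real (nat \<lceil>real n / l\<rceil>) * ln q)"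
      using q by (simp add: exp_of_nat_mult)
    \<comment> \<open>Now \<open>ln q \<le> 0\<close>, so dropping the ceiling can only increase the
      exponent.\<close>
    also have "\<dots> \<le> exp (real n / l * ln q)"
      using mult_right_mono_neg[OF real_nat_ceiling_ge[of "real n / l"], of "ln q"] False q
      by simp
    finally show ?thesis
      unfolding q_def[symmetric] exponent by simp
  qed
qed

section \<open>From the suprema to the theorem\<close>

lemma max_edge_length_bound:
  assumes "max_edge_length E = ereal l" "{u, v} \<in> E"
  shows "dist u v \<le> l"
proof -
  have "ereal (norm (u - v)) \<le> max_edge_length E"
    unfolding max_edge_length_def using assms(2) by (intro Sup_upper) blast
  with assms(1) show ?thesis
    by (simp add: dist_norm)
qed

theorem lemma7p2:
  fixes V :: "(real ^ 'd::finite) set" and E :: "(real ^ 'd) set set"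
    and dmax :: nat and lmax :: real
  assumes "simple_graph V E"
    and "max_degree V E = enat dmax" and "dmax \<ge> 2"
    and "max_edge_length E = ereal lmax"
  shows "\<forall>p::real. 0 < p \<and> p \<le> 1 \<longrightarrow>
     (\<exists>\<psi>::real. \<forall>v\<in>V. \<forall>n::nat. escape_prob V E p v n \<le> 2 * exp (- real n * \<psi>)) \<and>
     (\<forall>v\<in>V. \<forall>n::nat. escape_prob V E p v n
        \<le> 2 * exp (- real n * (1 / lmax * ln (1 / (p * (real dmax - 1)))))) \<and>
     (p < 1 / (real dmax - 1) \<longrightarrow>
        (\<exists>C c::real. 0 < c \<and> (\<forall>v\<in>V. \<forall>n::nat. escape_prob V E p v n \<le> C * exp (- c * real n))))"
proof (intro allI impI, elim conjE)
  fix p :: real assume p: "0 < p" "p \<le> 1"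
  have deg: "degree E v \<le> enat dmax" if "v \<in> V" for v
    using SUP_upper[OF that, of "degree E"] assms(2) by (simp add: max_degree_def)
  \<comment> \<open>An edge is wanted because its distinct ends force \<open>lmax > 0\<close>.
    Without edges all degrees would vanish, against \<open>dmax \<ge> 2\<close>.\<close>
  have "E \<noteq> {}"
  proof
    assume "E = {}"
    then have "max_degree V E \<le> 0"
      unfolding max_degree_def by (intro SUP_least) (simp add: degree_def zero_enat_def)
    with assms(2,3) show False
      by (simp add: zero_enat_def)
  qed
  then obtain u w where "{u, w} \<in> E" "u \<noteq> w"
    using assms(1) unfolding simple_graph_def by blast
  then have lmax: "0 < lmax"
    using max_edge_length_bound[OF assms(4), of u w] zero_less_dist_iff[of u w] by linarith
  define \<psi> where "\<psi> = 1 / lmax * ln (1 / (p * (real dmax - 1)))"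
  have bound: "\<forall>v\<in>V. \<forall>n. escape_prob V E p v n \<le> 2 * exp (- real n * \<psi>)"
    unfolding \<psi>_def
    using escape_prob_le_exp[OF assms(1) deg assms(3) max_edge_length_bound[OF assms(4)] lmax p]
    by blast
  have "0 < \<psi>" if "p < 1 / (real dmax - 1)"
  proof -
    have "0 < p * (real dmax - 1)" "p * (real dmax - 1) < 1"
      using that p assms(3) by (simp_all add: field_simps)
    then show ?thesis
      unfolding \<psi>_def using lmax by (intro mult_pos_pos ln_gt_zero) (simp_all add: less_divide_eq)
  qed
  \<comment> \<open>The witnesses for exponential decay are \<open>C = 2\<close> and
    \<open>c = \<psi>\<close>.\<close>
  moreover have "\<forall>v\<in>V. \<forall>n. escape_prob V E p v n \<le> 2 * exp (- \<psi> * real n)"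
    using bound by (simp add: mult.commute)
  ultimately show "(\<exists>\<psi>::real. \<forall>v\<in>V. \<forall>n::nat. escape_prob V E p v n \<le> 2 * exp (- real n * \<psi>)) \<and>
     (\<forall>v\<in>V. \<forall>n::nat. escape_prob V E p v n
        \<le> 2 * exp (- real n * (1 / lmax * ln (1 / (p * (real dmax - 1)))))) \<and>
     (p < 1 / (real dmax - 1) \<longrightarrow>
        (\<exists>C c::real. 0 < c \<and> (\<forall>v\<in>V. \<forall>n::nat. escape_prob V E p v n \<le> C * exp (- c * real n))))"
    using bound unfolding \<psi>_def[symmetric] by blast
qed

end
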